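(* Let $\tilde\gamma$ be the rescaled curve shortening flow in $\mathbb{R}^3$, i.e. a family of closed curves $\tilde\gamma(\tau,\cdot):S^1\to\mathbb{R}^3$ satisfying $$\partial_\tau\tilde{\gamma}=\frac{1}{2}\tilde\gamma+\frac{\tilde\gamma'\times(\tilde\gamma''\times\tilde\gamma')}{|\tilde\gamma'|^4},$$ and assume that $$\psi=\arcsin\frac{\langle\tilde\gamma,\tilde\gamma'\rangle}{|\tilde\gamma||\tilde\gamma'|}\neq\pm\frac{\pi}{2}$$ at all points. Then $$\frac{d}{d\tau}\int_{S^1}F(\tilde\gamma,\tilde\gamma')\,dx=-\int_{S^1}\Big|\kappa+\frac{1}{2}\langle\tilde\gamma,\nu\rangle\Big|^2\rho(\tilde\gamma,\tilde\gamma')\,dx-\int_{S^1}\left[\frac{1}{4}-\Big(1+|\tilde\gamma|b(|\tilde\gamma|)-\log\cos\psi\Big)\frac{\kappa^2}{|\tilde\gamma|^2\cos^2\psi}\right]\big|\mathrm{Proj}_{\nu\times\tilde\gamma'}\tilde\gamma\big|^2\rho(\tilde\gamma,\tilde\gamma')\,dx,$$ where, with $\psi=\psi(\xi,\eta)=\arcsin\frac{\langle\xi,\eta\rangle}{|\xi||\eta|}$, $$F(\xi,\eta)=\frac{|\eta|}{|\xi|}\Big(h(\psi)-|\xi|b(|\xi|)\cos\psi\Big),\qquad \rho(\xi,\eta)=\frac{|\eta|}{|\xi|}\frac{1}{\cos\psi},$$ $$h(\psi)=\psi\sin\psi+\cos\psi\log\cos\psi,\qquad b(r)=\frac{r}{4}-\frac{\log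 r}{r}-\frac{1-\log2}{2r}.$$
   Context: Let $\gamma:(0,T)\times S^1\to\mathbb{R}^3$ be a (smooth, regular) parametrized closed curve moving by curvature, $\partial_t\gamma=\kappa\nu$, whose first singularity appears at the point $0$ after finite time $T$. The rescaled flow is $\tau=-\log(T-t)$, $\tilde\gamma(\tau,x)=(T-t)^{-1/2}\gamma(t,x)$; it satisfies the equation displayed in the claim. The prime $'$ denotes the derivative in $x\in S^1$. For a curve, $\kappa=\frac{|\gamma''\times\gamma'|}{|\gamma'|^3}$ is the curvature and $\nu=\frac{\gamma'\times(\gamma''\times\gamma')}{|\gamma'||\gamma''\times\gamma'|}$ is the unit normal vector; in the claim $\kappa,\nu$ are those of $\tilde\gamma(\tau,\cdot)$. At points where $\kappa=0$, $\nu$ is understood as any (measurably chosen) unit vector orthogonal to $\tilde\gamma'$. $\mathrm{Proj}_w v$ denotes the orthogonal projection of $v$ onto the line spanned by $w$. It is understood that $\tilde\gamma\neq0$ so that the expressions are defined. *)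

theory Defs
  imports "HOL-Analysis.Analysis"
begin

text \<open>A function on the circle of length \<open>2\<pi>\<close> is represented by its \<open>2\<pi>\<close>-periodic lift to the real
  line, and its integral over the circle by the integral over \<open>{0..2 * pi}\<close>.\<close>

definition circle_periodic :: "(real \<Rightarrow> 'a) \<Rightarrow> bool" where
  "circle_periodic f \<longleftrightarrow> (\<forall>x. f (x + 2 * pi) = f x)"

definition circle_integral :: "(real \<Rightarrow> real) \<Rightarrow> real" where
  "circle_integral f = integral {0..2 * pi} f"

text \<open>\<open>C_diff n S f\<close>: for open \<open>S\<close>, all iterated directional derivatives of \<open>f\<close> of order at most \<open>n\<close>
  exist and are continuous on \<open>S\<close>.\<close>

primrec C_diff ::
  "nat \<Rightarrow> 'a::real_normed_vector set \<Rightarrow> ('a \<Rightarrow> 'b::real_normed_vector) \<Rightarrow> bool" where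
  "C_diff 0 S f \<longleftrightarrow> continuous_on S f"
| "C_diff (Suc n) S f \<longleftrightarrow>
     (\<forall>x\<in>S. f differentiable (at x)) \<and> (\<forall>v. C_diff n S (\<lambda>x. frechet_derivative f (at x) v))"

definition C_infinity ::
  "'a::real_normed_vector set \<Rightarrow> ('a \<Rightarrow> 'b::real_normed_vector) \<Rightarrow> bool" where
  "C_infinity S f \<longleftrightarrow> (\<forall>n. C_diff n S f)"

definition deriv1 :: "(real \<Rightarrow> real^3) \<Rightarrow> real \<Rightarrow> real^3" where
  "deriv1 c x = vector_derivative c (at x)"

definition deriv2 :: "(real \<Rightarrow> real^3) \<Rightarrow> real \<Rightarrow> real^3" where
  "deriv2 c = deriv1 (deriv1 c)"

definition curvature :: "(real \<Rightarrow> real^3) \<Rightarrow> real \<Rightarrow> real" where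
  "curvature c x = norm (cross3 (deriv2 c x) (deriv1 c x)) / norm (deriv1 c x) ^ 3"

text \<open>The principal normal is determined only where the curvature does not vanish; elsewhere any
  measurable choice of a unit vector orthogonal to the curve is allowed.\<close>

definition is_unit_normal :: "(real \<Rightarrow> real^3) \<Rightarrow> (real \<Rightarrow> real^3) \<Rightarrow> bool" where
  "is_unit_normal c \<nu> \<longleftrightarrow>
     circle_periodic \<nu> \<and> \<nu> \<in> borel_measurable lebesgue \<and>
     (\<forall>x. curvature c x \<noteq> 0 \<longrightarrow>
        \<nu> x = (1 / (norm (deriv1 c x) * norm (cross3 (deriv2 c x) (deriv1 c x)))) *\<^sub>R
              cross3 (deriv1 c x) (cross3 (deriv2 c x) (deriv1 c x))) \<and>
     (\<forall>x. curvature c x = 0 \<longrightarrow> norm (\<nu> x) = 1 \<and> \<nu> x \<bullet> deriv1 c x = 0)"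

text \<open>A smooth family of regular closed curves, with time in an open interval \<open>I\<close>. For the rescaling
  of a flow on \<open>{0<..<T}\<close> by \<open>\<tau> = - ln (T - t)\<close> this interval is \<open>{- ln T<..}\<close>.\<close>

definition rescaled_csf :: "real set \<Rightarrow> (real \<Rightarrow> real \<Rightarrow> real^3) \<Rightarrow> bool" where
  "rescaled_csf I \<gamma> \<longleftrightarrow>
     open I \<and> is_interval I \<and>
     C_infinity (I \<times> UNIV) (\<lambda>(\<tau>, x). \<gamma> \<tau> x) \<and>
     (\<forall>\<tau>\<in>I. circle_periodic (\<gamma> \<tau>)) \<and>
     (\<forall>\<tau>\<in>I. \<forall>x. deriv1 (\<gamma> \<tau>) x \<noteq> 0) \<and>
     (\<forall>\<tau>\<in>I. \<forall>x.
        ((\<lambda>s. \<gamma> s x) has_vector_derivative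
           (1 / 2) *\<^sub>R \<gamma> \<tau> x +
           (1 / norm (deriv1 (\<gamma> \<tau>) x) ^ 4) *\<^sub>R
             cross3 (deriv1 (\<gamma> \<tau>) x) (cross3 (deriv2 (\<gamma> \<tau>) x) (deriv1 (\<gamma> \<tau>) x)))
          (at \<tau>))"

definition proj_line :: "real^3 \<Rightarrow> real^3 \<Rightarrow> real^3" where
  "proj_line w v = ((v \<bullet> w) / (w \<bullet> w)) *\<^sub>R w"

definition psi :: "real^3 \<Rightarrow> real^3 \<Rightarrow> real" where
  "psi \<xi> \<eta> = arcsin ((\<xi> \<bullet> \<eta>) / (norm \<xi> * norm \<eta>))"

definition h_fun :: "real \<Rightarrow> real" where
  "h_fun p = p * sin p + cos p * ln (cos p)"

definition b_fun :: "real \<Rightarrow> real" where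
  "b_fun r = r / 4 - ln r / r - (1 - ln 2) / (2 * r)"

definition F_fun :: "real^3 \<Rightarrow> real^3 \<Rightarrow> real" where
  "F_fun \<xi> \<eta> = norm \<eta> / norm \<xi> *
     (h_fun (psi \<xi> \<eta>) - norm \<xi> * b_fun (norm \<xi>) * cos (psi \<xi> \<eta>))"

definition rho :: "real^3 \<Rightarrow> real^3 \<Rightarrow> real" where
  "rho \<xi> \<eta> = norm \<eta> / norm \<xi> * (1 / cos (psi \<xi> \<eta>))"

end

theory Submission
  imports Defs
begin

text \<open>
  Write \<open>W = \<partial>F / \<partial>\<xi> - d/dx (\<partial>F / \<partial>\<eta>)\<close> for the Euler-Lagrange vector of \<open>F\<close> along the curve. For a closed
  curve, integration by parts gives \<open>d/d\<tau> \<integral>F = \<integral>\<langle>W, V\<rangle>\<close>, where \<open>V = \<xi> / 2 + \<kappa> \<nu>\<close> is the velocity of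
  the flow. Since \<open>F\<close> is homogeneous of degree one in \<open>\<eta>\<close>, the vector \<open>W\<close> is orthogonal to \<open>\<eta>\<close>, so only
  normal components matter.

  The function \<open>h\<close> solves \<open>h + h'' = 1 / cos \<psi>\<close>. Hence in the plane of \<open>\<xi>\<close> and \<open>\<eta>\<close> the Hessian of \<open>F\<close>
  in \<open>\<eta>\<close>, orthogonally to \<open>\<eta>\<close>, is \<open>\<rho> / \<bar>\<eta>\<bar>\<^sup>2\<close>, and \<open>b\<close> is such that straight lines give \<open>W = - \<rho> \<xi>\<^sup>\<bottom> / 2\<close>, with
  \<open>\<xi>\<^sup>\<bottom>\<close> the normal part of \<open>\<xi>\<close>. For planar curves this means \<open>W = - \<rho> V\<^sup>\<bottom>\<close>. Orthogonally to
  that plane, the Hessian is instead \<open>\<rho> L / \<bar>\<eta>\<bar>\<^sup>2\<close> with \<open>L = ln (cos \<psi>) - \<bar>\<xi>\<bar> b(\<bar>\<xi>\<bar>)\<close>. Therefore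
  \<open>\<langle>W, V\<rangle> = - \<rho> (\<bar>V\<^sup>\<bottom>\<bar>\<^sup>2 - (1 - L) m\<^sup>2)\<close>, where \<open>m\<close> is the component of the curvature vector orthogonal
  to \<open>\<xi>\<close> and \<open>\<eta>\<close>. Splitting \<open>V\<^sup>\<bottom>\<close> along \<open>\<nu>\<close> and along the binormal, and comparing areas in the normal
  plane to express \<open>m\<close> by the binormal component of \<open>\<xi>\<close>, gives the two integrands of the claim.

  The computation is carried out in the inner products of \<open>\<xi>\<close> and \<open>\<eta>\<close>, in which \<open>F\<close> is an explicit
  elementary function (\<open>F_fun_eq_energy_density\<close>). The lemma \<open>euler_lagrange_identity\<close> is the
  resulting pointwise identity between the time derivative of \<open>F\<close>, the spatial derivative of the momentum
  term and the two integrands. Differentiation under the integral sign, the equality of the mixed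
  partial derivatives of the flow (\<open>partial_commute\<close>) and periodicity turn it into the theorem.
\<close>

section \<open>Partial derivatives of smooth functions of two variables\<close>

lemma C_infinity_frechet:
  assumes "C_infinity S f"
  shows "C_infinity S (\<lambda>z. frechet_derivative f (at z) v)"
  using assms unfolding C_infinity_def by (metis C_diff.simps(2))

lemma C_infinity_continuous: "C_infinity S f \<Longrightarrow> continuous_on S f"
  unfolding C_infinity_def by (metis C_diff.simps(1))

lemma C_infinity_has_derivative:
  assumes "C_infinity S f" "z \<in> S"
  shows "(f has_derivative frechet_derivative f (at z)) (at z)"
proof -
  have "C_diff 1 S f" using assms unfolding C_infinity_def by blast
  then show ?thesis using assms(2) frechet_derivative_works by auto
qed

definition partial_t :: "(real \<times> real \<Rightarrow> 'b::real_normed_vector) \<Rightarrow> real \<times> real \<Rightarrow> 'b" where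
  "partial_t f z = frechet_derivative f (at z) (1, 0)"

definition partial_x :: "(real \<times> real \<Rightarrow> 'b::real_normed_vector) \<Rightarrow> real \<times> real \<Rightarrow> 'b" where
  "partial_x f z = frechet_derivative f (at z) (0, 1)"

lemma C_infinity_partial:
  assumes "C_infinity S f"
  shows "C_infinity S (partial_t f)" "C_infinity S (partial_x f)"
  using C_infinity_frechet[OF assms] unfolding partial_t_def[abs_def] partial_x_def[abs_def] by blast+

lemma has_vector_derivative_partial_t:
  assumes "C_infinity S f" "(t, x) \<in> S"
  shows "((\<lambda>s. f (s, x)) has_vector_derivative partial_t f (t, x)) (at t)"
proof -
  let ?f' = "frechet_derivative f (at (t, x))"
  have f': "(f has_derivative ?f') (at (t, x))"
    by (rule C_infinity_has_derivative[OF assms])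
  have "((\<lambda>s. (s, x)) has_derivative (\<lambda>h. (h, 0))) (at t)"
    by (auto intro!: derivative_eq_intros)
  then have "((\<lambda>s. f (s, x)) has_derivative (\<lambda>h. ?f' (h, 0))) (at t)"
    using has_derivative_compose f' by blast
  moreover have "?f' (h, 0) = h *\<^sub>R partial_t f (t, x)" for h
    using linear_cmul[OF has_derivative_linear[OF f'], of h "(1, 0)"] by (simp add: partial_t_def)
  ultimately show ?thesis by (simp add: has_vector_derivative_def)
qed

lemma has_vector_derivative_partial_x:
  assumes "C_infinity S f" "(t, x) \<in> S"
  shows "((\<lambda>y. f (t, y)) has_vector_derivative partial_x f (t, x)) (at x)"
proof -
  let ?f' = "frechet_derivative f (at (t, x))"
  have f': "(f has_derivative ?f') (at (t, x))"
    by (rule C_infinity_has_derivative[OF assms])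
  have "((\<lambda>y. (t, y)) has_derivative (\<lambda>h. (0, h))) (at x)"
    by (auto intro!: derivative_eq_intros)
  then have "((\<lambda>y. f (t, y)) has_derivative (\<lambda>h. ?f' (0, h))) (at x)"
    using has_derivative_compose f' by blast
  moreover have "?f' (0, h) = h *\<^sub>R partial_x f (t, x)" for h
    using linear_cmul[OF has_derivative_linear[OF f'], of h "(0, 1)"] by (simp add: partial_x_def)
  ultimately show ?thesis by (simp add: has_vector_derivative_def)
qed

lemma continuous_on_slice:
  assumes "continuous_on (I \<times> UNIV) g" "s \<in> I"
  shows "continuous_on X (\<lambda>y. g (s, y))"
  by (rule continuous_on_compose2[OF assms(1)]) (use assms(2) in \<open>auto intro!: continuous_intros\<close>)

text \<open>Equality of mixed partials comes from differentiating
  \<open>f (t, y) - f (t, a) = \<integral>\<^sub>a\<^sup>y \<partial>\<^sub>x f (t, u) du\<close> first in \<open>t\<close>, under the integral sign, and then in \<open>y\<close>,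
  by the fundamental theorem of calculus.\<close>

lemma partial_commute:
  fixes f :: "real \<times> real \<Rightarrow> 'b::banach"
  assumes f: "C_infinity (I \<times> UNIV) f" and I: "open I" "convex I" and t: "t \<in> I"
  shows "partial_x (partial_t f) (t, x) = partial_t (partial_x f) (t, x)"
proof -
  note smooth = f C_infinity_partial[OF f]
    C_infinity_partial[OF C_infinity_partial(1)[OF f]] C_infinity_partial[OF C_infinity_partial(2)[OF f]]
  note cont = smooth[THEN C_infinity_continuous]
  let ?g = "partial_t (partial_x f)"
  define a where "a = x - 1"
  have increment: "partial_t f (t, y) - partial_t f (t, a) = integral {a..y} (\<lambda>u. ?g (t, u))"
    if y: "a \<le> y" for y
  proof -
    have ftc: "integral {a..y} (\<lambda>u. partial_x f (s, u)) = f (s, y) - f (s, a)" if "s \<in> I" for s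
      by (rule integral_unique, rule fundamental_theorem_of_calculus[OF y],
          rule has_vector_derivative_at_within, rule has_vector_derivative_partial_x[OF f])
        (use that in auto)
    have "((\<lambda>s. integral (cbox a y) (\<lambda>u. partial_x f (s, u))) has_vector_derivative
        integral (cbox a y) (\<lambda>u. ?g (t, u))) (at t within I)"
    proof (rule leibniz_rule_vector_derivative[OF _ _ _ t I(2)])
      show "((\<lambda>s. partial_x f (s, u)) has_vector_derivative ?g (s, u)) (at s within I)"
        if "s \<in> I" for s u
        using has_vector_derivative_partial_t[OF smooth(3)] that
        by (auto intro: has_vector_derivative_at_within)
      show "(\<lambda>u. partial_x f (s, u)) integrable_on cbox a y" if "s \<in> I" for s
        by (rule integrable_continuous) (rule continuous_on_slice[OF cont(3) that])
      show "continuous_on (I \<times> cbox a y) (\<lambda>(s, u). ?g (s, u))"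
        using continuous_on_subset[OF cont(6), of "I \<times> cbox a y"]
        by (auto simp: case_prod_unfold)
    qed
    then have "((\<lambda>s. integral (cbox a y) (\<lambda>u. partial_x f (s, u))) has_vector_derivative
        integral (cbox a y) (\<lambda>u. ?g (t, u))) (at t)"
      using at_within_open[OF t I(1)] by simp
    then have "((\<lambda>s. f (s, y) - f (s, a)) has_vector_derivative
        integral {a..y} (\<lambda>u. ?g (t, u))) (at t)"
      unfolding cbox_interval
      by (rule has_vector_derivative_transform_within_open[OF _ I(1) t]) (rule ftc)
    moreover have "((\<lambda>s. f (s, y) - f (s, a)) has_vector_derivative
        partial_t f (t, y) - partial_t f (t, a)) (at t)"
      using t by (intro has_vector_derivative_diff has_vector_derivative_partial_t[OF f]) auto
    ultimately show ?thesis by (rule vector_derivative_unique_at[symmetric])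
  qed
  have x: "x \<in> {a<..<x + 1}" by (simp add: a_def)
  have "((\<lambda>y. integral {a..y} (\<lambda>u. ?g (t, u))) has_vector_derivative ?g (t, x)) (at x within {a..x + 1})"
    by (rule integral_has_vector_derivative[OF continuous_on_slice[OF cont(6) t]])
      (use x in auto)
  then have "((\<lambda>y. integral {a..y} (\<lambda>u. ?g (t, u))) has_vector_derivative ?g (t, x)) (at x)"
    using at_within_Icc_at[of a x "x + 1"] x by simp
  then have "((\<lambda>y. partial_t f (t, y) - partial_t f (t, a)) has_vector_derivative ?g (t, x)) (at x)"
    by (rule has_vector_derivative_transform_within_open[OF _ open_greaterThanLessThan x])
      (simp add: increment)
  moreover have "((\<lambda>y. partial_t f (t, y) - partial_t f (t, a)) has_vector_derivative
      partial_x (partial_t f) (t, x)) (at x)"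
    using t by (auto intro!: derivative_eq_intros has_vector_derivative_partial_x[OF smooth(2)])
  ultimately show ?thesis by (rule vector_derivative_unique_at[symmetric])
qed

section \<open>The integrand in terms of inner products\<close>

text \<open>The definitions below take the arguments \<open>A = \<langle>\<xi>, \<xi>\<rangle>\<close>, \<open>B = \<langle>\<xi>, \<eta>\<rangle>\<close> and \<open>C = \<langle>\<eta>, \<eta>\<rangle>\<close>. With them
  \<open>sqrt (gram A B C) = \<bar>\<xi>\<bar> \<bar>\<eta>\<bar> cos \<psi>\<close>, and \<open>\<psi>\<close> becomes an arctangent, which is differentiable without a
  condition on its argument.\<close>

definition gram :: "real \<Rightarrow> real \<Rightarrow> real \<Rightarrow> real" where
  "gram A B C = A * C - B\<^sup>2"

definition gram_angle :: "real \<Rightarrow> real \<Rightarrow> real \<Rightarrow> real" where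
  "gram_angle A B C = arctan (B / sqrt (gram A B C))"

text \<open>This is \<open>ln (cos \<psi>) - \<bar>\<xi>\<bar> b(\<bar>\<xi>\<bar>)\<close>: the two logarithms of \<open>\<bar>\<xi>\<bar>\<close> cancel.\<close>

definition log_term :: "real \<Rightarrow> real \<Rightarrow> real \<Rightarrow> real" where
  "log_term A B C = ln (gram A B C) / 2 - ln C / 2 - A / 4 + (1 - ln 2) / 2"

definition energy_density :: "real \<Rightarrow> real \<Rightarrow> real \<Rightarrow> real" where
  "energy_density A B C = (B * gram_angle A B C + sqrt (gram A B C) * log_term A B C) / A"

text \<open>The derivatives of \<open>gram_angle\<close> and \<open>log_term\<close> together amount to the third summand in the
  first bracket.\<close>

definition energy_density_deriv :: "real \<Rightarrow> real \<Rightarrow> real \<Rightarrow> real \<Rightarrow> real \<Rightarrow> real \<Rightarrow> real" where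
  "energy_density_deriv A B C A' B' C' =
     (B' * gram_angle A B C
      + (A' * C + A * C' - 2 * B * B') / (2 * sqrt (gram A B C)) * log_term A B C
      + sqrt (gram A B C) * A' * (1 / (2 * A) - 1 / 4)) / A
     - A' * energy_density A B C / A"

lemma gram_vec: "gram (\<xi> \<bullet> \<xi>) (\<xi> \<bullet> \<eta>) (\<eta> \<bullet> \<eta>) = (norm \<xi> * norm \<eta>)\<^sup>2 - (\<xi> \<bullet> \<eta>)\<^sup>2"
  by (simp add: gram_def power_mult_distrib dot_square_norm)

text \<open>The angle condition is exactly strictness in the Cauchy-Schwarz inequality.\<close>

lemma gram_vec_pos:
  assumes "\<xi> \<noteq> 0" "\<eta> \<noteq> 0" "psi \<xi> \<eta> \<noteq> pi / 2" "psi \<xi> \<eta> \<noteq> - (pi / 2)"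
  shows "gram (\<xi> \<bullet> \<xi>) (\<xi> \<bullet> \<eta>) (\<eta> \<bullet> \<eta>) > 0"
proof -
  have p: "norm \<xi> * norm \<eta> > 0" using assms by simp
  have "\<xi> \<bullet> \<eta> \<noteq> norm \<xi> * norm \<eta>" "\<xi> \<bullet> \<eta> \<noteq> - (norm \<xi> * norm \<eta>)"
    using assms p by (auto simp: psi_def)
  then have "\<bar>\<xi> \<bullet> \<eta>\<bar> < norm \<xi> * norm \<eta>"
    using Cauchy_Schwarz_ineq2[of \<xi> \<eta>] by linarith
  then have "(\<xi> \<bullet> \<eta>)\<^sup>2 < (norm \<xi> * norm \<eta>)\<^sup>2"
    using p by (metis abs_ge_zero power2_abs power_strict_mono zero_less_numeral)
  then show ?thesis by (simp add: gram_vec)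
qed

context
  fixes \<xi> \<eta> :: "real^3" and A B C q :: real
  assumes nz: "\<xi> \<noteq> 0" "\<eta> \<noteq> 0"
  defines "A \<equiv> \<xi> \<bullet> \<xi>" and "B \<equiv> \<xi> \<bullet> \<eta>" and "C \<equiv> \<eta> \<bullet> \<eta>" and "q \<equiv> sqrt (gram A B C)"
  assumes D: "gram A B C > 0"
begin

lemma AC_pos: "A > 0" "C > 0" "q > 0" "q\<^sup>2 = A * C - B\<^sup>2"
  using nz D by (auto simp: A_def C_def q_def gram_def)

lemma norm_vec: "norm \<xi> = sqrt A" "norm \<eta> = sqrt C"
  by (simp_all add: A_def C_def norm_eq_sqrt_inner)

lemma sin_psi_vec: "sin (psi \<xi> \<eta>) = B / (norm \<xi> * norm \<eta>)"
  and cos_psi_vec: "cos (psi \<xi> \<eta>) = q / (norm \<xi> * norm \<eta>)"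
  and psi_eq_gram_angle: "psi \<xi> \<eta> = gram_angle A B C"
proof -
  define u where "u = B / (norm \<xi> * norm \<eta>)"
  have rp: "norm \<xi> * norm \<eta> > 0" using nz by simp
  have rp2: "(norm \<xi> * norm \<eta>)\<^sup>2 = A * C" by (simp add: A_def C_def power_mult_distrib dot_square_norm)
  have one_minus: "1 - u\<^sup>2 = (q / (norm \<xi> * norm \<eta>))\<^sup>2"
    unfolding u_def power_divide rp2 using AC_pos by (simp add: field_simps)
  have root: "sqrt (1 - u\<^sup>2) = q / (norm \<xi> * norm \<eta>)"
    unfolding one_minus using AC_pos rp by simp
  have "u\<^sup>2 < 1" using one_minus AC_pos rp by (smt (verit) divide_pos_pos zero_less_power)
  then have u: "-1 < u" "u < 1" by (auto simp: power2_less_1_iff abs_square_less_1)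
  have p: "psi \<xi> \<eta> = arcsin u" by (simp add: psi_def u_def B_def)
  show "sin (psi \<xi> \<eta>) = B / (norm \<xi> * norm \<eta>)" using u by (simp add: p u_def)
  show "cos (psi \<xi> \<eta>) = q / (norm \<xi> * norm \<eta>)" using u by (simp add: p cos_arcsin root)
  show "psi \<xi> \<eta> = gram_angle A B C"
    using u rp by (simp add: p arcsin_arctan root gram_angle_def flip: q_def) (use nz in \<open>simp add: u_def\<close>)
qed

lemma log_term_vec: "ln (cos (psi \<xi> \<eta>)) - norm \<xi> * b_fun (norm \<xi>) = log_term A B C"
proof -
  have r: "norm \<xi> > 0" using nz by simp
  have "norm \<xi> * b_fun (norm \<xi>) = (norm \<xi>)\<^sup>2 / 4 - ln (norm \<xi>) - (1 - ln 2) / 2"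
    using r by (simp add: b_fun_def field_simps power2_eq_square)
  moreover have "(norm \<xi>)\<^sup>2 = A" by (simp add: A_def dot_square_norm)
  moreover have "ln (norm \<xi>) = ln A / 2" "ln (norm \<eta>) = ln C / 2" "ln q = ln (gram A B C) / 2"
    using AC_pos D by (simp_all add: norm_vec ln_sqrt q_def)
  ultimately show ?thesis
    using AC_pos nz by (simp add: cos_psi_vec ln_div ln_mult log_term_def)
qed

lemma F_fun_eq_energy_density: "F_fun \<xi> \<eta> = energy_density A B C"
proof -
  have r: "norm \<xi> > 0" "norm \<eta> > 0" using nz by auto
  have "F_fun \<xi> \<eta> = norm \<eta> / norm \<xi> *
     (psi \<xi> \<eta> * sin (psi \<xi> \<eta>) + cos (psi \<xi> \<eta>) * log_term A B C)"
    unfolding F_fun_def h_fun_def log_term_vec[symmetric] by (simp add: algebra_simps)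
  also have "\<dots> = (B * psi \<xi> \<eta> + q * log_term A B C) / (norm \<xi>)\<^sup>2"
    using r by (simp add: sin_psi_vec cos_psi_vec field_simps power2_eq_square)
  also have "(norm \<xi>)\<^sup>2 = A" by (simp add: A_def dot_square_norm)
  finally show ?thesis by (simp add: energy_density_def psi_eq_gram_angle q_def)
qed

lemma rho_vec: "rho \<xi> \<eta> = C / q"
proof -
  have "C = norm \<eta> * norm \<eta>" by (simp add: C_def dot_square_norm power2_eq_square)
  then show ?thesis
  using nz AC_pos by (simp add: rho_def cos_psi_vec field_simps)
qed

lemma rcos_vec: "(norm \<xi>)\<^sup>2 * (cos (psi \<xi> \<eta>))\<^sup>2 = q\<^sup>2 / C"
  using nz by (simp add: cos_psi_vec C_def power_divide power_mult_distrib dot_square_norm)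

end

section \<open>Derivatives of the energy density and of its momentum\<close>

lemma has_derivative_parts:
  assumes A: "(A has_real_derivative A') (at t)" and B: "(B has_real_derivative B') (at t)"
    and C: "(C has_real_derivative C') (at t)"
    and pos: "A t > 0" "C t > 0" "gram (A t) (B t) (C t) > 0"
    and D': "D' = A' * C t + A t * C' - 2 * B t * B'"
  shows has_derivative_sqrt_gram: "((\<lambda>s. sqrt (gram (A s) (B s) (C s))) has_real_derivative
       D' / (2 * sqrt (gram (A t) (B t) (C t)))) (at t)"
    and has_derivative_gram_angle: "((\<lambda>s. gram_angle (A s) (B s) (C s)) has_real_derivative
       (B' * sqrt (gram (A t) (B t) (C t)) - B t * (D' / (2 * sqrt (gram (A t) (B t) (C t))))) / (A t * C t)) (at t)"
    and has_derivative_log_term: "((\<lambda>s. log_term (A s) (B s) (C s)) has_real_derivative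
       D' / (2 * gram (A t) (B t) (C t)) - C' / (2 * C t) - A' / 4) (at t)"
proof -
  let ?D = "\<lambda>s. gram (A s) (B s) (C s)"
  have D: "(?D has_real_derivative D') (at t)"
    unfolding gram_def D' by (rule derivative_eq_intros A B C refl | simp)+
  define q where "q = sqrt (?D t)"
  have q: "q > 0" "q\<^sup>2 = ?D t" using pos by (auto simp: q_def)
  show root: "((\<lambda>s. sqrt (?D s)) has_real_derivative D' / (2 * sqrt (?D t))) (at t)"
    using pos by (auto intro!: derivative_eq_intros D simp: field_simps)
  have AC: "q\<^sup>2 + (B t)\<^sup>2 = A t * C t" by (simp add: q gram_def)
  have inv: "inverse (1 + (B t / q)\<^sup>2) = q\<^sup>2 / (A t * C t)"
    unfolding AC[symmetric] using q(1) add_pos_nonneg[of "q\<^sup>2" "(B t)\<^sup>2"]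
    by (simp add: power_divide field_simps del: q(2))
  have "((\<lambda>s. arctan (B s / sqrt (?D s))) has_real_derivative
     inverse (1 + (B t / q)\<^sup>2) * ((B' * q - B t * (D' / (2 * q))) / (q * q))) (at t)"
    using q(1) unfolding q_def
    by (intro DERIV_chain2[OF DERIV_arctan] DERIV_divide B root) auto
  then show "((\<lambda>s. gram_angle (A s) (B s) (C s)) has_real_derivative
       (B' * sqrt (?D t) - B t * (D' / (2 * sqrt (?D t)))) / (A t * C t)) (at t)"
    unfolding gram_angle_def inv unfolding q_def[symmetric] using q(1)
    by (simp add: power2_eq_square)
  show "((\<lambda>s. log_term (A s) (B s) (C s)) has_real_derivative
       D' / (2 * ?D t) - C' / (2 * C t) - A' / 4) (at t)"
    unfolding log_term_def using pos
    by (auto intro!: derivative_eq_intros D A C simp: field_simps)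
qed

lemma has_derivative_energy_density:
  assumes A: "(A has_real_derivative A') (at t)" and B: "(B has_real_derivative B') (at t)"
    and C: "(C has_real_derivative C') (at t)"
    and pos: "A t > 0" "C t > 0" "gram (A t) (B t) (C t) > 0"
  shows "((\<lambda>s. energy_density (A s) (B s) (C s)) has_real_derivative
      energy_density_deriv (A t) (B t) (C t) A' B' C') (at t)"
proof -
  define D' where "D' = A' * C t + A t * C' - 2 * B t * B'"
  define q where "q = sqrt (gram (A t) (B t) (C t))"
  define p where "p = gram_angle (A t) (B t) (C t)"
  define L where "L = log_term (A t) (B t) (C t)"
  note parts = has_derivative_parts[OF A B C pos D'_def]
  have q: "q > 0" "q\<^sup>2 = gram (A t) (B t) (C t)" using pos by (auto simp: q_def)
  have deriv: "((\<lambda>s. energy_density (A s) (B s) (C s)) has_real_derivative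
     (((B' * p + ((B' * q - B t * (D' / (2 * q))) / (A t * C t)) * B t) +
      (D' / (2 * q) * L + (D' / (2 * q\<^sup>2) - C' / (2 * C t) - A' / 4) * q)) * A t
      - (B t * p + q * L) * A') / (A t * A t)) (at t)"
    unfolding energy_density_def p_def L_def q(2) unfolding q_def
    by (intro DERIV_divide DERIV_add DERIV_mult A B parts) (use pos in simp)
  \<comment> \<open>Since \<open>B t / q = tan \<psi>\<close> and \<open>d (ln (cos \<psi>)) = - tan \<psi> d\<psi>\<close>, the derivatives of \<open>\<psi>\<close> and of
      \<open>ln (cos \<psi>)\<close> cancel, and only the derivative of \<open>- \<bar>\<xi>\<bar> b(\<bar>\<xi>\<bar>)\<close> survives.\<close>
  have key: "(B' * q - B t * (D' / (2 * q))) / (A t * C t) * B t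
      + (D' / (2 * q\<^sup>2) - C' / (2 * C t) - A' / 4) * q = q * A' * (1 / (2 * A t) - 1 / 4)"
  proof -
    have "A t * C t = q\<^sup>2 + (B t)\<^sup>2" by (simp add: q gram_def)
    then show ?thesis unfolding D'_def using q(1) pos(1,2)
      by (simp add: divide_simps) algebra
  qed
  have "energy_density_deriv (A t) (B t) (C t) A' B' C' =
     (B' * p + D' / (2 * q) * L + q * A' * (1 / (2 * A t) - 1 / 4)) / A t
     - A' * ((B t * p + q * L) / A t) / A t"
    by (simp add: energy_density_deriv_def energy_density_def D'_def p_def L_def q_def)
  also have "\<dots> = (((B' * p + ((B' * q - B t * (D' / (2 * q))) / (A t * C t)) * B t) +
      (D' / (2 * q) * L + (D' / (2 * q\<^sup>2) - C' / (2 * C t) - A' / 4) * q)) * A t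
      - (B t * p + q * L) * A') / (A t * A t)"
    unfolding key[symmetric] using pos(1) by (simp add: field_simps)
  finally show ?thesis using deriv by simp
qed

text \<open>The momentum \<open>\<partial>F / \<partial>\<eta> = (\<psi> / A) \<xi> + (L / q) (\<eta> - (B / A) \<xi>)\<close>, with \<open>L\<close> the logarithmic term and
  \<open>q = sqrt (gram A B C)\<close>, paired with a velocity \<open>V\<close> that enters only through \<open>X = \<langle>\<xi>, V\<rangle>\<close> and
  \<open>Y = \<langle>\<eta>, V\<rangle>\<close>. It is the boundary term of the integration by parts.\<close>

definition flux :: "real \<Rightarrow> real \<Rightarrow> real \<Rightarrow> real \<Rightarrow> real \<Rightarrow> real" where
  "flux A B C X Y = gram_angle A B C * X / A + log_term A B C * (Y - B * X / A) / sqrt (gram A B C)"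

definition flux_deriv ::
  "real \<Rightarrow> real \<Rightarrow> real \<Rightarrow> real \<Rightarrow> real \<Rightarrow> real \<Rightarrow> real \<Rightarrow> real \<Rightarrow> real \<Rightarrow> real \<Rightarrow> real" where
  "flux_deriv A B C X Y A' B' C' X' Y' =
    (let q = sqrt (gram A B C); q' = (A' * C + A * C' - 2 * B * B') / (2 * q);
         p = gram_angle A B C; p' = (B' * q - B * q') / (A * C);
         L = log_term A B C; L' = q' / q - C' / (2 * C) - A' / 4;
         u = Y - B * X / A; u' = Y' - ((B' * X + B * X') * A - B * X * A') / A\<^sup>2
     in ((p' * X + p * X') * A - p * X * A') / A\<^sup>2 + ((L' * u + L * u') * q - L * u * q') / q\<^sup>2)"

lemma has_derivative_flux:
  assumes A: "(A has_real_derivative A') (at t)" and B: "(B has_real_derivative B') (at t)"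
    and C: "(C has_real_derivative C') (at t)"
    and X: "(X has_real_derivative X') (at t)" and Y: "(Y has_real_derivative Y') (at t)"
    and pos: "A t > 0" "C t > 0" "gram (A t) (B t) (C t) > 0"
  shows "((\<lambda>s. flux (A s) (B s) (C s) (X s) (Y s)) has_real_derivative
      flux_deriv (A t) (B t) (C t) (X t) (Y t) A' B' C' X' Y') (at t)"
proof -
  define D' where "D' = A' * C t + A t * C' - 2 * B t * B'"
  define q where "q = sqrt (gram (A t) (B t) (C t))"
  note parts = has_derivative_parts[OF A B C pos D'_def]
  have q: "q > 0" "gram (A t) (B t) (C t) = q * q" using pos by (auto simp: q_def)
  have L': "((\<lambda>s. log_term (A s) (B s) (C s)) has_real_derivative
       D' / (2 * q) / q - C' / (2 * C t) - A' / 4) (at t)"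
    using parts(3) by (simp add: q(2) mult.assoc)
  show ?thesis
    unfolding flux_def flux_deriv_def Let_def power2_eq_square D'_def[symmetric] q_def[symmetric]
  proof (rule DERIV_cong, (rule parts(1,2)[folded q_def] L' A B C X Y
        DERIV_divide DERIV_add DERIV_diff DERIV_mult | use pos in force)+)
  qed (use q(1) in \<open>simp add: q_def[symmetric] algebra_simps\<close>)
qed

lemma continuous_on_energy_density [continuous_intros]:
  assumes cont: "continuous_on S A" "continuous_on S B" "continuous_on S C"
    and pos: "\<And>z. z \<in> S \<Longrightarrow> A z > 0 \<and> C z > 0 \<and> gram (A z) (B z) (C z) > 0"
  shows "continuous_on S (\<lambda>z. energy_density (A z) (B z) (C z))"
    and continuous_on_energy_density_deriv [continuous_intros]:
      "\<lbrakk>continuous_on S A'; continuous_on S B'; continuous_on S C'\<rbrakk> \<Longrightarrow>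
       continuous_on S (\<lambda>z. energy_density_deriv (A z) (B z) (C z) (A' z) (B' z) (C' z))"
proof -
  have nz: "A z \<noteq> 0" "C z \<noteq> 0" "gram (A z) (B z) (C z) \<noteq> 0"
    "0 < gram (A z) (B z) (C z)" if "z \<in> S" for z
    using pos[OF that] by auto
  have gram: "continuous_on S (\<lambda>z. gram (A z) (B z) (C z))"
    unfolding gram_def by (intro continuous_intros cont)
  have angle: "continuous_on S (\<lambda>z. gram_angle (A z) (B z) (C z))"
    unfolding gram_angle_def by (intro continuous_intros cont gram) (use nz in auto)
  have log: "continuous_on S (\<lambda>z. log_term (A z) (B z) (C z))"
    unfolding log_term_def by (intro continuous_intros cont gram) (use nz in auto)
  show energy_density: "continuous_on S (\<lambda>z. energy_density (A z) (B z) (C z))"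
    unfolding energy_density_def by (intro continuous_intros cont gram angle log) (use nz in auto)
  show "continuous_on S (\<lambda>z. energy_density_deriv (A z) (B z) (C z) (A' z) (B' z) (C' z))"
    if "continuous_on S A'" "continuous_on S B'" "continuous_on S C'"
    unfolding energy_density_deriv_def
    by (intro continuous_intros cont gram angle log energy_density that) (use nz in auto)
qed

section \<open>The first variation along the flow\<close>

text \<open>The pointwise form of the theorem. Here \<open>\<kappa>\<close> is the curvature, \<open>k = \<langle>\<xi>, \<nu>\<rangle>\<close>, the velocity is
  \<open>V = \<xi> / 2 + \<kappa> \<nu>\<close> and the second derivative of the curve is \<open>C \<kappa> \<nu> + h \<eta>\<close>; the numbers \<open>a\<close> and \<open>c\<close>
  are the inner products of \<open>\<xi>\<close> and \<open>\<eta>\<close> with the spatial derivative of \<open>V\<close>. These last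
  two cancel because \<open>flux\<close> is the momentum, and the terms with \<open>\<psi>\<close> cancel because \<open>\<partial>F / \<partial>\<xi>\<close>
  and the derivative of the momentum both contain \<open>\<psi>\<close> with the coefficient
  \<open>\<eta> / A - (2 B / A\<^sup>2) \<xi>\<close>. What is left is affine in the logarithmic term.\<close>

lemma euler_lagrange_identity:
  fixes A B C \<kappa> k h a c :: real
  assumes pos: "A > 0" "C > 0" "gram A B C > 0"
    and X: "X = A / 2 + \<kappa> * k" and Y: "Y = B / 2" and B': "B' = C + C * \<kappa> * k + h * B"
    and Y': "Y' = C * \<kappa> * k / 2 + h * B / 2 + C * \<kappa>\<^sup>2 + c"
  shows "energy_density_deriv A B C (2 * X) (Y + a) (2 * c)
    - flux_deriv A B C X Y (2 * B) B' (2 * (h * C)) (Y + a) Y'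
   = - (C / sqrt (gram A B C)) * ((\<kappa> + k / 2)\<^sup>2
      + (1 / 4 - (1 - log_term A B C) * (\<kappa>\<^sup>2 / (gram A B C / C))) * ((gram A B C - C * k\<^sup>2) / C))"
proof -
  define q where "q = sqrt (gram A B C)"
  define p where "p = gram_angle A B C"
  define L where "L = log_term A B C"
  have q: "q > 0" "gram A B C = q\<^sup>2" using pos by (auto simp: q_def)
  have AC: "A * C = q\<^sup>2 + B\<^sup>2" using q by (simp add: gram_def)
  \<comment> \<open>The spatial derivatives of \<open>q\<close>, of \<open>\<psi>\<close> and of the logarithmic term on the curve.\<close>
  have q': "(2 * B * C + A * (2 * (h * C)) - 2 * B * B') / (2 * q) = h * q - B * C * \<kappa> * k / q"
    using q(1) AC unfolding B' by (simp add: field_simps) algebra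
  have p': "(B' * q - B * (h * q - B * C * \<kappa> * k / q)) / (A * C) = q / A + \<kappa> * k * C / q"
    unfolding B' using q(1) pos(1,2) AC by (simp add: divide_simps) algebra
  have L': "(h * q - B * C * \<kappa> * k / q) / q - 2 * (h * C) / (2 * C) - 2 * B / 4
      = - (B * C * \<kappa> * k / q\<^sup>2) - B / 2"
    using q(1) pos by (simp add: field_simps power2_eq_square)
  have u: "Y - B * X / A = - (B * \<kappa> * k / A)"
    using pos by (simp add: X Y field_simps)
  \<comment> \<open>The part without the logarithmic term.\<close>
  have free: "X * q * (1 / A - 1 / 2) / A - (q / A + \<kappa> * k * C / q) * X / A
     - (- (B * C * \<kappa> * k / q\<^sup>2) - B / 2) * (- (B * \<kappa> * k / A)) / q
    = - (C / q) * (\<kappa> * k + q\<^sup>2 / (4 * C) + \<kappa>\<^sup>2 * k\<^sup>2 * C / q\<^sup>2)"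
  proof -
    have "C = (q\<^sup>2 + B\<^sup>2) / A" using AC pos by (simp add: field_simps)
    then show ?thesis
    unfolding X using q(1) pos by (simp add: divide_simps) algebra
  qed
  \<comment> \<open>The coefficient of the logarithmic term.\<close>
  have log: "(2 * X * C + A * (2 * c) - 2 * B * (Y + a)) / (2 * q) / A - 2 * X * q / A\<^sup>2
     - (Y' - ((B' * X + B * (Y + a)) * A - B * X * (2 * B)) / A\<^sup>2) / q
     + (- (B * \<kappa> * k / A)) * (h * q - B * C * \<kappa> * k / q) / q\<^sup>2
    = - (C / q) * (\<kappa>\<^sup>2 - \<kappa>\<^sup>2 * k\<^sup>2 * C / q\<^sup>2)"
  proof -
    have "C = (q\<^sup>2 + B\<^sup>2) / A" using AC pos by (simp add: field_simps)
    then show ?thesis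
    unfolding X Y B' Y' using q(1) pos by (simp add: divide_simps) algebra
  qed
  have "energy_density_deriv A B C (2 * X) (Y + a) (2 * c)
    - flux_deriv A B C X Y (2 * B) B' (2 * (h * C)) (Y + a) Y' =
    (X * q * (1 / A - 1 / 2) / A - (q / A + \<kappa> * k * C / q) * X / A
     - (- (B * C * \<kappa> * k / q\<^sup>2) - B / 2) * (- (B * \<kappa> * k / A)) / q)
    + L * ((2 * X * C + A * (2 * c) - 2 * B * (Y + a)) / (2 * q) / A - 2 * X * q / A\<^sup>2
     - (Y' - ((B' * X + B * (Y + a)) * A - B * X * (2 * B)) / A\<^sup>2) / q
     + (- (B * \<kappa> * k / A)) * (h * q - B * C * \<kappa> * k / q) / q\<^sup>2)"
    unfolding energy_density_deriv_def energy_density_def flux_deriv_def Let_def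
      p_def[symmetric] L_def[symmetric] q_def[symmetric] q' p' L' u
    using q(1) pos(1) by (simp add: divide_simps) algebra
  also have "\<dots> = - (C / q) * ((\<kappa> + k / 2)\<^sup>2
      + (1 / 4 - (1 - L) * (\<kappa>\<^sup>2 / (q\<^sup>2 / C))) * ((q\<^sup>2 - C * k\<^sup>2) / C))"
    unfolding free log using q(1) pos(2) by (simp add: divide_simps) algebra
  finally show ?thesis unfolding q(2)[symmetric] unfolding L_def q_def .
qed

section \<open>Curvature and normal of a space curve\<close>

lemma gram_det_cross3:
  "(x \<bullet> cross3 y z)\<^sup>2 = (x \<bullet> x) * (y \<bullet> y) * (z \<bullet> z) + 2 * (x \<bullet> y) * (y \<bullet> z) * (x \<bullet> z)
     - (x \<bullet> x) * (y \<bullet> z)\<^sup>2 - (y \<bullet> y) * (x \<bullet> z)\<^sup>2 - (z \<bullet> z) * (x \<bullet> y)\<^sup>2"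
  by (simp add: cross3_def inner_vec_def sum_3 vector_def) algebra

text \<open>At a point of vanishing curvature both sides of the last equation are zero, so the arbitrary
  choice of the normal there does no harm.\<close>

lemma unit_normal_frame:
  assumes \<nu>: "is_unit_normal c \<nu>" and reg: "deriv1 c x \<noteq> 0"
  shows "norm (\<nu> x) = 1" and "\<nu> x \<bullet> deriv1 c x = 0"
    and curvature_vector: "(1 / norm (deriv1 c x) ^ 4) *\<^sub>R
      cross3 (deriv1 c x) (cross3 (deriv2 c x) (deriv1 c x)) = curvature c x *\<^sub>R \<nu> x"
proof -
  define \<eta> w where "\<eta> = deriv1 c x" and "w = cross3 (deriv2 c x) \<eta>"
  have \<eta>: "norm \<eta> > 0" using reg by (simp add: \<eta>_def)
  have "\<eta> \<bullet> w = 0" by (simp add: w_def dot_cross_self)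
  then have "(norm (cross3 \<eta> w))\<^sup>2 = (norm \<eta> * norm w)\<^sup>2"
    using norm_cross_dot[of \<eta> w] by simp
  then have norm_w: "norm (cross3 \<eta> w) = norm \<eta> * norm w" by (simp add: power2_eq_iff_nonneg)
  have \<kappa>: "curvature c x = norm w / norm \<eta> ^ 3" by (simp add: curvature_def w_def \<eta>_def)
  have "norm (\<nu> x) = 1 \<and> \<nu> x \<bullet> \<eta> = 0 \<and>
    (1 / norm \<eta> ^ 4) *\<^sub>R cross3 \<eta> w = curvature c x *\<^sub>R \<nu> x"
  proof (cases "curvature c x = 0")
    case True
    then have "w = 0" using \<eta> by (simp add: \<kappa>)
    then show ?thesis using \<nu> True by (simp add: is_unit_normal_def \<eta>_def)
  next
    case False
    then have w: "norm w > 0" by (auto simp: \<kappa>)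
    have "\<nu> x = (1 / (norm \<eta> * norm w)) *\<^sub>R cross3 \<eta> w"
      using \<nu> False by (simp add: is_unit_normal_def \<eta>_def w_def)
    then show ?thesis
      using w \<eta> norm_w by (simp add: \<kappa> dot_cross_self field_simps power4_eq_xxxx power3_eq_cube)
  qed
  then show "norm (\<nu> x) = 1" "\<nu> x \<bullet> deriv1 c x = 0"
    "(1 / norm (deriv1 c x) ^ 4) *\<^sub>R
      cross3 (deriv1 c x) (cross3 (deriv2 c x) (deriv1 c x)) = curvature c x *\<^sub>R \<nu> x"
    by (simp_all add: \<eta>_def w_def)
qed

lemma deriv2_decomposition:
  assumes "is_unit_normal c \<nu>" "deriv1 c x \<noteq> 0"
  defines "\<eta> \<equiv> deriv1 c x"
  shows "deriv2 c x = ((\<eta> \<bullet> \<eta>) * curvature c x) *\<^sub>R \<nu> x + ((\<eta> \<bullet> deriv2 c x) / (\<eta> \<bullet> \<eta>)) *\<^sub>R \<eta>"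
proof -
  have C: "\<eta> \<bullet> \<eta> > 0" using assms by simp
  have "norm \<eta> ^ 4 = (\<eta> \<bullet> \<eta>)\<^sup>2" by (metis dot_square_norm power2_eq_square power4_eq_xxxx mult.assoc)
  then have "curvature c x *\<^sub>R \<nu> x =
      (1 / (\<eta> \<bullet> \<eta>)\<^sup>2) *\<^sub>R ((\<eta> \<bullet> \<eta>) *\<^sub>R deriv2 c x - (\<eta> \<bullet> deriv2 c x) *\<^sub>R \<eta>)"
    using curvature_vector[OF assms(1,2)] by (simp add: Lagrange \<eta>_def)
  then have "(\<eta> \<bullet> \<eta>) *\<^sub>R (curvature c x *\<^sub>R \<nu> x) =
      deriv2 c x - ((\<eta> \<bullet> deriv2 c x) / (\<eta> \<bullet> \<eta>)) *\<^sub>R \<eta>"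
    using C by (simp add: scaleR_diff_right power2_eq_square)
  then show ?thesis by simp
qed

text \<open>The tangent, \<open>n\<close> and their cross product are an orthogonal frame, so the squared component of
  \<open>\<xi>\<close> along the cross product is what the other two leave over.\<close>

lemma norm_proj_binormal:
  assumes "norm n = 1" "n \<bullet> \<eta> = 0" "\<eta> \<noteq> 0"
  shows "(norm (proj_line (cross3 n \<eta>) \<xi>))\<^sup>2 =
    (gram (\<xi> \<bullet> \<xi>) (\<xi> \<bullet> \<eta>) (\<eta> \<bullet> \<eta>) - (\<eta> \<bullet> \<eta>) * (\<xi> \<bullet> n)\<^sup>2) / (\<eta> \<bullet> \<eta>)"
proof -
  define w where "w = cross3 n \<eta>"
  have C: "\<eta> \<bullet> \<eta> \<noteq> 0" using assms by simp
  have w: "w \<bullet> w = \<eta> \<bullet> \<eta>"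
    using norm_cross_dot[of n \<eta>] assms by (simp add: w_def dot_square_norm)
  have "n \<bullet> n = 1" using assms by (simp add: dot_square_norm)
  then have "(\<xi> \<bullet> w)\<^sup>2 = gram (\<xi> \<bullet> \<xi>) (\<xi> \<bullet> \<eta>) (\<eta> \<bullet> \<eta>) - (\<eta> \<bullet> \<eta>) * (\<xi> \<bullet> n)\<^sup>2"
    unfolding w_def gram_det_cross3 gram_def using assms(2) by simp
  moreover have "(norm (proj_line w \<xi>))\<^sup>2 = (\<xi> \<bullet> w)\<^sup>2 / (\<eta> \<bullet> \<eta>)"
  proof -
    have "(norm (proj_line w \<xi>))\<^sup>2 = ((\<xi> \<bullet> w) / (w \<bullet> w))\<^sup>2 * (w \<bullet> w)"
      by (simp add: proj_line_def power_mult_distrib power_divide dot_square_norm)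
    then show ?thesis using C w by (simp add: power2_eq_square)
  qed
  ultimately show ?thesis by (simp add: w_def)
qed

section \<open>The energy identity\<close>

lemma has_real_derivative_inner:
  assumes "(f has_vector_derivative f') (at t)" "(g has_vector_derivative g') (at t)"
  shows "((\<lambda>s. f s \<bullet> g s) has_real_derivative (f t \<bullet> g' + f' \<bullet> g t)) (at t)"
  using bounded_bilinear.has_vector_derivative[OF bounded_bilinear_inner assms]
  by (simp add: has_real_derivative_iff_has_vector_derivative)

lemma circle_periodic_deriv1:
  assumes "circle_periodic c"
  shows "circle_periodic (deriv1 c)"
  unfolding circle_periodic_def
proof
  fix x
  have shift: "(c has_vector_derivative d) (at x)"
    if "(c has_vector_derivative d) (at (x + p))" "\<And>y. c (y + p) = c y" for d x p
  proof -
    have "((\<lambda>y. y + p) has_vector_derivative 1) (at x)"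
      by (auto intro!: derivative_eq_intros)
    from vector_diff_chain_at[OF this that(1)] show ?thesis
      using that(2) by (simp add: o_def)
  qed
  have per: "c (y + 2 * pi) = c y" "c (y + - (2 * pi)) = c y" for y
    using assms unfolding circle_periodic_def by (simp, metis add.commute add.left_commute add_minus_cancel)
  have "(c has_vector_derivative d) (at (x + 2 * pi)) \<longleftrightarrow> (c has_vector_derivative d) (at x)" for d
    using shift[of d x "2 * pi"] shift[of d "x + 2 * pi" "- (2 * pi)"] per by auto
  then show "deriv1 c (x + 2 * pi) = deriv1 c x" by (simp add: deriv1_def vector_derivative_def)
qed

theorem theorem3:
  fixes I :: "real set" and \<gamma> :: "real \<Rightarrow> real \<Rightarrow> real^3"
    and \<tau> :: real and \<nu> :: "real \<Rightarrow> real^3"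
  assumes flow: "rescaled_csf I \<gamma>"
    and nonzero: "\<And>s x. s \<in> I \<Longrightarrow> \<gamma> s x \<noteq> 0"
    and angle: "\<And>s x. s \<in> I \<Longrightarrow>
      psi (\<gamma> s x) (deriv1 (\<gamma> s) x) \<noteq> pi / 2 \<and> psi (\<gamma> s x) (deriv1 (\<gamma> s) x) \<noteq> - (pi / 2)"
    and time: "\<tau> \<in> I"
    and normal: "is_unit_normal (\<gamma> \<tau>) \<nu>"
  shows "((\<lambda>s. circle_integral (\<lambda>x. F_fun (\<gamma> s x) (deriv1 (\<gamma> s) x))) has_real_derivative
      - circle_integral (\<lambda>x.
          \<bar>curvature (\<gamma> \<tau>) x + 1 / 2 * (\<gamma> \<tau> x \<bullet> \<nu> x)\<bar>\<^sup>2 * rho (\<gamma> \<tau> x) (deriv1 (\<gamma> \<tau>) x))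
      - circle_integral (\<lambda>x.
          (1 / 4 -
            (1 + norm (\<gamma> \<tau> x) * b_fun (norm (\<gamma> \<tau> x)) - ln (cos (psi (\<gamma> \<tau> x) (deriv1 (\<gamma> \<tau>) x)))) *
            ((curvature (\<gamma> \<tau>) x)\<^sup>2 /
              ((norm (\<gamma> \<tau> x))\<^sup>2 * (cos (psi (\<gamma> \<tau> x) (deriv1 (\<gamma> \<tau>) x)))\<^sup>2))) *
          (norm (proj_line (cross3 (\<nu> x) (deriv1 (\<gamma> \<tau>) x)) (\<gamma> \<tau> x)))\<^sup>2 *
          rho (\<gamma> \<tau> x) (deriv1 (\<gamma> \<tau>) x))) (at \<tau>)"
proof -
  let ?G = "\<lambda>(s, y). \<gamma> s y" and ?S = "I \<times> (UNIV :: real set)"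
  have I: "open I" "convex I" and smooth: "C_infinity ?S ?G"
    and periodic: "circle_periodic (\<gamma> \<tau>)"
    and regular: "\<And>s y. s \<in> I \<Longrightarrow> deriv1 (\<gamma> s) y \<noteq> 0"
    using flow time by (auto simp: rescaled_csf_def is_interval_convex)
  define \<xi> where "\<xi> = ?G"
  define \<eta> where "\<eta> = partial_x \<xi>"
  define \<zeta> where "\<zeta> = partial_x \<eta>"
  define V where "V = partial_t \<xi>"
  define V' where "V' = partial_t \<eta>"
  have \<xi>: "\<gamma> s y = \<xi> (s, y)" for s y by (simp add: \<xi>_def)
  have smooths: "C_infinity ?S \<xi>" "C_infinity ?S \<eta>" "C_infinity ?S \<zeta>" "C_infinity ?S V" "C_infinity ?S V'"
    using smooth by (auto simp: \<xi>_def \<eta>_def \<zeta>_def V_def V'_def intro: C_infinity_partial)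
  note cont = smooths[THEN C_infinity_continuous]
  have dx\<xi>: "((\<lambda>y. \<xi> (s, y)) has_vector_derivative \<eta> (s, x)) (at x)"
    and dx\<eta>: "((\<lambda>y. \<eta> (s, y)) has_vector_derivative \<zeta> (s, x)) (at x)"
    and dt\<xi>: "((\<lambda>r. \<xi> (r, x)) has_vector_derivative V (s, x)) (at s)"
    and dt\<eta>: "((\<lambda>r. \<eta> (r, x)) has_vector_derivative V' (s, x)) (at s)"
    and dxV: "((\<lambda>y. V (s, y)) has_vector_derivative V' (s, x)) (at x)"
    if "s \<in> I" for s x
    using has_vector_derivative_partial_x[OF smooths(1), of s x]
      has_vector_derivative_partial_x[OF smooths(2), of s x]
      has_vector_derivative_partial_t[OF smooths(1), of s x]
      has_vector_derivative_partial_t[OF smooths(2), of s x]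
      has_vector_derivative_partial_x[OF smooths(4), of s x]
      partial_commute[OF smooths(1) I that, of x] that
    by (simp_all add: \<eta>_def \<zeta>_def V_def V'_def)
  have deriv1: "deriv1 (\<gamma> s) y = \<eta> (s, y)" if "s \<in> I" for s y
    unfolding deriv1_def \<xi> by (rule vector_derivative_at[OF dx\<xi>[OF that]])
  have deriv2: "deriv2 (\<gamma> \<tau>) y = \<zeta> (\<tau>, y)" for y
  proof -
    have "deriv1 (\<gamma> \<tau>) = (\<lambda>y. \<eta> (\<tau>, y))" using deriv1[OF time] by auto
    then show ?thesis
      unfolding deriv2_def using vector_derivative_at[OF dx\<eta>[OF time]] by (simp add: deriv1_def)
  qed
  define A where "A z = \<xi> z \<bullet> \<xi> z" for z
  define B where "B z = \<xi> z \<bullet> \<eta> z" for z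
  define C where "C z = \<eta> z \<bullet> \<eta> z" for z
  have nz: "\<xi> (s, y) \<noteq> 0" "\<eta> (s, y) \<noteq> 0" if "s \<in> I" for s y
    using nonzero[OF that, of y] regular[OF that, of y] deriv1[OF that, of y] by (auto simp: \<xi>)
  have gram_pos: "gram (A (s, y)) (B (s, y)) (C (s, y)) > 0" if "s \<in> I" for s y
    unfolding A_def B_def C_def
    using angle[OF that, of y] by (intro gram_vec_pos nz that) (auto simp: \<xi> deriv1[OF that, of y])
  have pos: "A z > 0" "C z > 0" "gram (A z) (B z) (C z) > 0" if "z \<in> ?S" for z
    using that nz gram_pos by (auto simp: A_def C_def)
  have contABC: "continuous_on ?S A" "continuous_on ?S B" "continuous_on ?S C"
    unfolding A_def B_def C_def by (intro continuous_intros cont)+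

  \<comment> \<open>The time derivative of the integrand, and differentiation under the integral sign.\<close>
  define DF where "DF z = energy_density_deriv (A z) (B z) (C z)
    (2 * (\<xi> z \<bullet> V z)) (\<eta> z \<bullet> V z + \<xi> z \<bullet> V' z) (2 * (\<eta> z \<bullet> V' z))" for z
  have contDF: "continuous_on ?S DF"
    unfolding DF_def by (intro continuous_intros contABC cont) (use pos in auto)
  have F: "F_fun (\<gamma> s y) (deriv1 (\<gamma> s) y) = energy_density (A (s, y)) (B (s, y)) (C (s, y))" if "s \<in> I" for s y
    unfolding deriv1[OF that] \<xi> A_def B_def C_def
    using gram_pos[OF that] by (intro F_fun_eq_energy_density nz that) (auto simp: A_def B_def C_def)
  have dF: "((\<lambda>s. energy_density (A (s, y)) (B (s, y)) (C (s, y))) has_real_derivative DF (s, y)) (at s)"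
    if s: "s \<in> I" for s y
    unfolding DF_def
  proof (rule has_derivative_energy_density)
    show "((\<lambda>s. A (s, y)) has_real_derivative 2 * (\<xi> (s, y) \<bullet> V (s, y))) (at s)"
      unfolding A_def
      by (rule DERIV_cong[OF has_real_derivative_inner[OF dt\<xi> dt\<xi>]])
        (use s in \<open>simp_all add: inner_commute\<close>)
    show "((\<lambda>s. B (s, y)) has_real_derivative \<eta> (s, y) \<bullet> V (s, y) + \<xi> (s, y) \<bullet> V' (s, y)) (at s)"
      unfolding B_def
      by (rule DERIV_cong[OF has_real_derivative_inner[OF dt\<xi> dt\<eta>]])
        (use s in \<open>simp_all add: inner_commute\<close>)
    show "((\<lambda>s. C (s, y)) has_real_derivative 2 * (\<eta> (s, y) \<bullet> V' (s, y))) (at s)"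
      unfolding C_def
      by (rule DERIV_cong[OF has_real_derivative_inner[OF dt\<eta> dt\<eta>]])
        (use s in \<open>simp_all add: inner_commute\<close>)
  qed (use pos s in auto)
  have "((\<lambda>s. integral (cbox 0 (2 * pi)) (\<lambda>y. energy_density (A (s, y)) (B (s, y)) (C (s, y))))
      has_field_derivative integral (cbox 0 (2 * pi)) (\<lambda>y. DF (\<tau>, y))) (at \<tau> within I)"
  proof (rule leibniz_rule_field_derivative[OF _ _ _ time I(2)])
    show "((\<lambda>s. energy_density (A (s, y)) (B (s, y)) (C (s, y))) has_field_derivative DF (s, y)) (at s within I)"
      if "s \<in> I" for s y
      using dF[OF that] by (rule has_field_derivative_at_within)
    have "continuous_on ?S (\<lambda>z. energy_density (A z) (B z) (C z))"
      by (intro continuous_intros contABC) (use pos in auto)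
    then show "(\<lambda>y. energy_density (A (s, y)) (B (s, y)) (C (s, y))) integrable_on cbox 0 (2 * pi)" if "s \<in> I" for s
      by (intro integrable_continuous continuous_on_slice[where g = "\<lambda>z. energy_density (A z) (B z) (C z)"]) (use that in auto)
    show "continuous_on (I \<times> cbox 0 (2 * pi)) (\<lambda>(s, y). DF (s, y))"
      using continuous_on_subset[OF contDF, of "I \<times> cbox 0 (2 * pi)"] by (auto simp: case_prod_unfold)
  qed
  then have "((\<lambda>s. integral {0..2 * pi} (\<lambda>y. energy_density (A (s, y)) (B (s, y)) (C (s, y))))
      has_real_derivative integral {0..2 * pi} (\<lambda>y. DF (\<tau>, y))) (at \<tau>)"
    using at_within_open[OF time I(1)] by simp
  then have leibniz: "((\<lambda>s. circle_integral (\<lambda>x. F_fun (\<gamma> s x) (deriv1 (\<gamma> s) x)))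
      has_real_derivative integral {0..2 * pi} (\<lambda>y. DF (\<tau>, y))) (at \<tau>)"
    by (rule has_field_derivative_transform_within_open[OF _ I(1) time])
      (simp add: circle_integral_def F)

  \<comment> \<open>The integration by parts: \<open>P\<close> is the momentum paired with the velocity.\<close>
  define X where "X y = \<xi> (\<tau>, y) \<bullet> V (\<tau>, y)" for y
  define Y where "Y y = \<eta> (\<tau>, y) \<bullet> V (\<tau>, y)" for y
  define P where "P y = flux (A (\<tau>, y)) (B (\<tau>, y)) (C (\<tau>, y)) (X y) (Y y)" for y
  define P' where "P' y = flux_deriv (A (\<tau>, y)) (B (\<tau>, y)) (C (\<tau>, y)) (X y) (Y y)
     (2 * B (\<tau>, y)) (C (\<tau>, y) + \<xi> (\<tau>, y) \<bullet> \<zeta> (\<tau>, y)) (2 * (\<eta> (\<tau>, y) \<bullet> \<zeta> (\<tau>, y)))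
     (Y y + \<xi> (\<tau>, y) \<bullet> V' (\<tau>, y)) (\<zeta> (\<tau>, y) \<bullet> V (\<tau>, y) + \<eta> (\<tau>, y) \<bullet> V' (\<tau>, y))" for y
  have dP: "(P has_real_derivative P' y) (at y)" for y
    unfolding P_def P'_def
  proof (rule has_derivative_flux)
    note d = dx\<xi>[OF time, of y] dx\<eta>[OF time, of y] dxV[OF time, of y]
    show "((\<lambda>y. A (\<tau>, y)) has_real_derivative 2 * B (\<tau>, y)) (at y)"
      unfolding A_def B_def
      by (rule DERIV_cong[OF has_real_derivative_inner[OF d(1) d(1)]]) (simp add: inner_commute)
    show "((\<lambda>y. B (\<tau>, y)) has_real_derivative C (\<tau>, y) + \<xi> (\<tau>, y) \<bullet> \<zeta> (\<tau>, y)) (at y)"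
      unfolding B_def C_def
      by (rule DERIV_cong[OF has_real_derivative_inner[OF d(1) d(2)]]) (simp add: inner_commute)
    show "((\<lambda>y. C (\<tau>, y)) has_real_derivative 2 * (\<eta> (\<tau>, y) \<bullet> \<zeta> (\<tau>, y))) (at y)"
      unfolding C_def
      by (rule DERIV_cong[OF has_real_derivative_inner[OF d(2) d(2)]]) (simp add: inner_commute)
    show "(X has_real_derivative Y y + \<xi> (\<tau>, y) \<bullet> V' (\<tau>, y)) (at y)"
      unfolding X_def Y_def
      by (rule DERIV_cong[OF has_real_derivative_inner[OF d(1) d(3)]]) (simp add: inner_commute)
    show "(Y has_real_derivative \<zeta> (\<tau>, y) \<bullet> V (\<tau>, y) + \<eta> (\<tau>, y) \<bullet> V' (\<tau>, y)) (at y)"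
      unfolding Y_def
      by (rule DERIV_cong[OF has_real_derivative_inner[OF d(2) d(3)]]) (simp add: inner_commute)
  qed (use pos time in auto)

  define \<kappa> where "\<kappa> = curvature (\<gamma> \<tau>)"
  have frame: "norm (\<nu> y) = 1" "\<nu> y \<bullet> \<eta> (\<tau>, y) = 0" for y
    using unit_normal_frame(1,2)[OF normal, of y] regular[OF time, of y] by (auto simp: deriv1[OF time])
  have velocity: "V (\<tau>, y) = (1 / 2) *\<^sub>R \<xi> (\<tau>, y) + \<kappa> y *\<^sub>R \<nu> y" for y
  proof -
    have "((\<lambda>s. \<gamma> s y) has_vector_derivative (1 / 2) *\<^sub>R \<gamma> \<tau> y + \<kappa> y *\<^sub>R \<nu> y) (at \<tau>)"
      using flow time curvature_vector[OF normal regular[OF time]]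
      by (auto simp: rescaled_csf_def \<kappa>_def)
    then show ?thesis
      using vector_derivative_unique_at[OF dt\<xi>[OF time]] by (auto simp: \<xi>)
  qed
  have acceleration: "\<zeta> (\<tau>, y) = (C (\<tau>, y) * \<kappa> y) *\<^sub>R \<nu> y
      + ((\<eta> (\<tau>, y) \<bullet> \<zeta> (\<tau>, y)) / C (\<tau>, y)) *\<^sub>R \<eta> (\<tau>, y)" for y
    using deriv2_decomposition[OF normal regular[OF time], of y]
    by (simp add: deriv1[OF time] deriv2 \<kappa>_def C_def)

  \<comment> \<open>The velocity is built from the curve, its curvature and \<open>\<nu>\<close>, which are all periodic.\<close>
  have "P (2 * pi) = P 0"
  proof -
    have "\<gamma> \<tau> (2 * pi) = \<gamma> \<tau> 0" "deriv1 (\<gamma> \<tau>) (2 * pi) = deriv1 (\<gamma> \<tau>) 0"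
      "deriv2 (\<gamma> \<tau>) (2 * pi) = deriv2 (\<gamma> \<tau>) 0"
      using periodic circle_periodic_deriv1[OF periodic]
        circle_periodic_deriv1[OF circle_periodic_deriv1[OF periodic]]
      by (simp_all add: circle_periodic_def deriv2_def) (metis add_0)+
    moreover have "\<nu> (2 * pi) = \<nu> 0"
      using normal by (simp add: is_unit_normal_def circle_periodic_def) (metis add_0)
    ultimately show ?thesis
      by (simp add: P_def A_def B_def C_def X_def Y_def velocity \<kappa>_def curvature_def
          deriv1[OF time] \<xi> deriv2)
  qed
  moreover have "(P' has_integral P (2 * pi) - P 0) {0..2 * pi}"
    using dP by (intro fundamental_theorem_of_calculus)
      (auto simp: has_real_derivative_iff_has_vector_derivative intro: has_vector_derivative_at_within)
  ultimately have P'0: "(P' has_integral 0) {0..2 * pi}" by simp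

  define \<rho> where "\<rho> y = rho (\<gamma> \<tau> y) (deriv1 (\<gamma> \<tau>) y)" for y
  define f1 where "f1 y = \<bar>\<kappa> y + 1 / 2 * (\<gamma> \<tau> y \<bullet> \<nu> y)\<bar>\<^sup>2 * \<rho> y" for y
  define f2 where "f2 y = (1 / 4 -
            (1 + norm (\<gamma> \<tau> y) * b_fun (norm (\<gamma> \<tau> y)) - ln (cos (psi (\<gamma> \<tau> y) (deriv1 (\<gamma> \<tau>) y)))) *
            ((\<kappa> y)\<^sup>2 /
              ((norm (\<gamma> \<tau> y))\<^sup>2 * (cos (psi (\<gamma> \<tau> y) (deriv1 (\<gamma> \<tau>) y)))\<^sup>2))) *
          (norm (proj_line (cross3 (\<nu> y) (deriv1 (\<gamma> \<tau>) y)) (\<gamma> \<tau> y)))\<^sup>2 * \<rho> y" for y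
  have \<rho>: "\<rho> y = C (\<tau>, y) / sqrt (gram (A (\<tau>, y)) (B (\<tau>, y)) (C (\<tau>, y)))" for y
    unfolding \<rho>_def deriv1[OF time] \<xi> A_def B_def C_def
    using gram_pos[OF time] by (intro rho_vec nz time) (auto simp: A_def B_def C_def)
  have pointwise: "DF (\<tau>, y) - P' y = - (f1 y + f2 y)" for y
  proof -
    let ?z = "(\<tau>, y)"
    let ?h = "\<eta> ?z \<bullet> \<zeta> ?z / C ?z" and ?k = "\<xi> ?z \<bullet> \<nu> y"
    have D: "gram (A ?z) (B ?z) (C ?z) > 0" and Cpos: "C ?z > 0" and Apos: "A ?z > 0"
      using pos time by auto
    note nz' = nz[OF time, of y] D[unfolded A_def B_def C_def]
    have \<xi>V: "X y = A ?z / 2 + \<kappa> y * ?k" and \<eta>V: "Y y = B ?z / 2"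
      using frame[of y] by (auto simp: X_def Y_def velocity A_def B_def inner_add_right inner_commute)
    have \<xi>\<zeta>: "C ?z + \<xi> ?z \<bullet> \<zeta> ?z = C ?z + C ?z * \<kappa> y * ?k + ?h * B ?z"
      by (subst acceleration) (simp add: inner_add_right B_def)
    have \<zeta>\<nu>: "\<zeta> ?z \<bullet> \<nu> y = C ?z * \<kappa> y"
      by (subst acceleration) (use frame[of y] in \<open>simp add: inner_add_left inner_add_right dot_square_norm inner_commute\<close>)
    have \<zeta>V: "\<zeta> ?z \<bullet> V ?z + c = C ?z * \<kappa> y * ?k / 2 + ?h * B ?z / 2 + C ?z * (\<kappa> y)\<^sup>2 + c" for c
      using \<xi>\<zeta> \<zeta>\<nu> by (simp add: velocity inner_add_right inner_commute power2_eq_square)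
    have "DF ?z - P' y = - (C ?z / sqrt (gram (A ?z) (B ?z) (C ?z))) * ((\<kappa> y + ?k / 2)\<^sup>2
      + (1 / 4 - (1 - log_term (A ?z) (B ?z) (C ?z)) * ((\<kappa> y)\<^sup>2 / (gram (A ?z) (B ?z) (C ?z) / C ?z)))
        * ((gram (A ?z) (B ?z) (C ?z) - C ?z * ?k\<^sup>2) / C ?z))"
      using euler_lagrange_identity[OF Apos Cpos D \<xi>V \<eta>V \<xi>\<zeta> \<zeta>V, of "\<xi> ?z \<bullet> V' ?z" "\<eta> ?z \<bullet> V' ?z"] Cpos
      by (simp add: DF_def P'_def X_def Y_def)
    also have "\<dots> = - (f1 y + f2 y)"
    proof -
      have L: "1 + norm (\<xi> ?z) * b_fun (norm (\<xi> ?z)) - ln (cos (psi (\<xi> ?z) (\<eta> ?z)))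
        = 1 - log_term (A ?z) (B ?z) (C ?z)"
        using log_term_vec[OF nz'] by (simp add: A_def B_def C_def)
      have cos: "(norm (\<xi> ?z))\<^sup>2 * (cos (psi (\<xi> ?z) (\<eta> ?z)))\<^sup>2 = gram (A ?z) (B ?z) (C ?z) / C ?z"
        using rcos_vec[OF nz'] D by (simp add: A_def B_def C_def)
      have proj: "(norm (proj_line (cross3 (\<nu> y) (\<eta> ?z)) (\<xi> ?z)))\<^sup>2 =
        (gram (A ?z) (B ?z) (C ?z) - C ?z * ?k\<^sup>2) / C ?z"
        unfolding A_def B_def C_def by (rule norm_proj_binormal[OF frame nz(2)[OF time]])
      have half: "\<kappa> y + ?k / 2 = \<kappa> y + 1 / 2 * ?k" by simp
      have split: "- r * (u\<^sup>2 + v * w) = - (\<bar>u\<bar>\<^sup>2 * r + v * w * r)" for r u v w :: real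
        by (simp add: algebra_simps)
      show ?thesis
        unfolding f1_def f2_def deriv1[OF time] \<xi> L cos proj \<rho> half by (rule split)
    qed
    finally show ?thesis .
  qed

  \<comment> \<open>The sum of the two integrands does not depend on \<open>\<nu>\<close>, but each of them depends on its choice
      where the curvature vanishes. Splitting the integral therefore uses that \<open>\<nu>\<close> is measurable.\<close>
  have f1: "f1 integrable_on {0..2 * pi}"
  proof -
    define g where "g y = (\<bar>\<kappa> y\<bar> + norm (\<xi> (\<tau>, y)) / 2)\<^sup>2 * \<rho> y" for y
    note slice = continuous_on_slice[OF cont(1) time, of UNIV] continuous_on_slice[OF cont(2) time, of UNIV]
      continuous_on_slice[OF cont(3) time, of UNIV]
    have \<kappa>: "continuous_on UNIV \<kappa>"
      unfolding \<kappa>_def curvature_def[abs_def] deriv2 deriv1[OF time]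
      by (intro continuous_intros continuous_on_cross slice) (use nz time in auto)
    have nonzero_gram: "gram (A (\<tau>, y)) (B (\<tau>, y)) (C (\<tau>, y)) \<noteq> 0" for y
      using gram_pos[OF time, of y] by simp
    have contr: "continuous_on UNIV \<rho>"
      unfolding \<rho> A_def B_def C_def gram_def
      by (intro continuous_intros slice)
        (use nonzero_gram in \<open>auto simp: A_def B_def C_def gram_def\<close>)
    have "f1 \<in> borel_measurable lebesgue"
    proof -
      have [measurable]: "\<kappa> \<in> borel_measurable lebesgue" "\<rho> \<in> borel_measurable lebesgue"
        "(\<lambda>y. \<xi> (\<tau>, y)) \<in> borel_measurable lebesgue"
        using \<kappa> contr slice(1)
        by (auto intro!: measurable_completion borel_measurable_continuous_onI)
      have [measurable]: "\<nu> \<in> borel_measurable lebesgue"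
        using normal by (simp add: is_unit_normal_def)
      show ?thesis unfolding f1_def \<xi> by measurable
    qed
    then have meas: "f1 \<in> borel_measurable (lebesgue_on {0..2 * pi})"
      by (rule measurable_restrict_space1)
    have int: "g integrable_on {0..2 * pi}"
      unfolding g_def
      by (intro integrable_continuous_real continuous_intros)
        (auto intro: continuous_on_subset \<kappa> contr slice(1))
    have "norm (f1 y) \<le> g y" for y
    proof -
      have "\<bar>\<xi> (\<tau>, y) \<bullet> \<nu> y\<bar> \<le> norm (\<xi> (\<tau>, y))"
        using Cauchy_Schwarz_ineq2[of "\<xi> (\<tau>, y)" "\<nu> y"] frame(1)[of y] by simp
      then have "\<bar>\<kappa> y + 1 / 2 * (\<xi> (\<tau>, y) \<bullet> \<nu> y)\<bar> \<le> \<bar>\<kappa> y\<bar> + norm (\<xi> (\<tau>, y)) / 2"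
        by linarith
      then have "\<bar>\<kappa> y + 1 / 2 * (\<xi> (\<tau>, y) \<bullet> \<nu> y)\<bar>\<^sup>2 \<le> (\<bar>\<kappa> y\<bar> + norm (\<xi> (\<tau>, y)) / 2)\<^sup>2"
        by (rule power_mono) simp
      moreover have "\<rho> y \<ge> 0" using pos[of "(\<tau>, y)"] time by (simp add: \<rho>)
      ultimately have "f1 y \<le> g y" "f1 y \<ge> 0"
        unfolding f1_def g_def \<xi> by (auto intro: mult_right_mono)
      then show ?thesis by simp
    qed
    with meas int show ?thesis
      by (intro measurable_bounded_by_integrable_imp_integrable[of f1 _ g]) auto
  qed
  have DF: "(\<lambda>y. DF (\<tau>, y)) integrable_on {0..2 * pi}"
    by (intro integrable_continuous_real continuous_on_slice[OF contDF time])
  have "f2 = (\<lambda>y. P' y - DF (\<tau>, y) - f1 y)" using pointwise by (auto simp: algebra_simps)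
  then have f2: "f2 integrable_on {0..2 * pi}"
    using f1 DF P'0 by (auto intro!: integrable_diff)
  have "integral {0..2 * pi} (\<lambda>y. DF (\<tau>, y)) = integral {0..2 * pi} (\<lambda>y. P' y - f1 y - f2 y)"
    using pointwise by (intro arg_cong[where f = "integral _"]) (auto simp: algebra_simps)
  also have "\<dots> = integral {0..2 * pi} P' - integral {0..2 * pi} f1 - integral {0..2 * pi} f2"
    using f1 f2 P'0 by (simp add: integral_diff integrable_diff has_integral_integrable)
  also have "integral {0..2 * pi} P' = 0" using P'0 by (rule integral_unique)
  finally show ?thesis
    using leibniz unfolding circle_integral_def f1_def[abs_def] f2_def[abs_def] \<rho>_def \<kappa>_def by simp
qed

end
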